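(* Let $A\in\{0,1\}$ be a treatment, $Y(1),Y(0)$ real-valued potential outcomes, $U=\{Y(1),Y(0)\}$, $Y=AY(1)+(1-A)Y(0)$, $Z$ a general (possibly vector-valued) instrumental variable and $\Pi=\mathrm{pr}(A=1\mid Z)$, following the causal diagram $Z\to\Pi\to A$, $U\to A$, $U\to Y$, $A\to Y$ described in the context. Suppose that (a) $\mathrm{pr}(A=1\mid\Pi,U)=\Pi+\delta\{Y(1)\}+\eta\{Y(0)\}$ with $\delta(\cdot)$ and $\eta(\cdot)$ non-decreasing functions; (b) $Y(1)$ and $Y(0)$ have non-negative distributional associations on each other, i.e., $\partial F(y_1\mid y_0)/\partial y_0\le 0$ and $\partial F(y_0\mid y_1)/\partial y_1\le 0$ for all $y_1$ and $y_0$; (c) the essential supremum of $Y(1)$ given $Y(0)$ does not depend on $Y(0)$, and the essential supremum of $Y(0)$ given $Y(1)$ does not depend on $Y(1)$. Then $$\mathrm{ACE}_1^{\mathrm{adj}}\ge \mathrm{ACE}^{\mathrm{unadj}}\ge \mathrm{ACE}_1^{\mathrm{true}},\qquad \mathrm{ACE}_0^{\mathrm{adj}}\ge \mathrm{ACE}^{\mathrm{unadj}}\ge \mathrm{ACE}_0^{\mathrm{true}},\qquad \mathrm{ACE}^{\mathrm{adj}}\ge \mathrm{ACE}^{\mathrm{unadj}}\ge \mathrm{ACE}^{\mathrm{true}}.$$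
   Context: The causal diagram is the directed acyclic graph with arrows $Z\to\Pi$, $\Pi\to A$, $U\to A$, $U\to Y$, $A\to Y$, where $U=\{Y(1),Y(0)\}$. It means: $Z$ (hence $\Pi$) is independent of $\{Y(1),Y(0)\}$; $A$ is conditionally independent of $Z$ given $(\Pi,U)$; and $Y=AY(1)+(1-A)Y(0)$. Everything is conditional on observed covariates, which are suppressed. $F(y_1\mid y_0)=\mathrm{pr}\{Y(1)\le y_1\mid Y(0)=y_0\}$ and $F(y_0\mid y_1)=\mathrm{pr}\{Y(0)\le y_0\mid Y(1)=y_1\}$. A random variable $V$ has a non-negative distributional association on a random variable $W$ if $\partial F(w\mid v)/\partial v\le 0$ for all $v,w$, where $F(w\mid v)=\mathrm{pr}(W\le w\mid V=v)$; for discrete variables partial differentiation is replaced by differencing between adjacent levels. True average causal effects: $\mathrm{ACE}_1^{\mathrm{true}}=E\{Y(1)\mid A=1\}-E\{Y(0)\mid A=1\}$, $\mathrm{ACE}_0^{\mathrm{true}}=E\{Y(1)\mid A=0\}-E\{Y(0)\mid A=0\}$, $\mathrm{ACE}^{\mathrm{true}}=E\{Y(1)\}-E\{Y(0)\}$. Unadjusted estimator: $\mathrm{ACE}^{\mathrm{unadj}}=E(Y\mid A=1)-E(Y\mid A=0)$. Adjusted estimators, with $\nu_a(\pi)=E(Y\mid A=a,\Pi=\pi)$ and $F$ denoting distributions of $\Pi$: $\mathrm{ACE}_1^{\mathrm{adj}}=E(Y\mid A=1)-\int\nu_0(\pi)\,F(d\pi\mid A=1)$, $\mathrm{ACE}_0^{\mathrm{adj}}=\int\nu_1(\pi)\,F(d\pi\mid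 A=0)-E(Y\mid A=0)$, $\mathrm{ACE}^{\mathrm{adj}}=\int\nu_1(\pi)\,F(d\pi)-\int\nu_0(\pi)\,F(d\pi)$. Conventions: all expectations appearing are assumed to exist and be finite, and all conditional quantities are assumed well defined (in particular $0<\Pi<1$ almost surely). *)

theory Defs
  imports "HOL-Probability.Probability"
begin

definition gen_by :: "'a measure \<Rightarrow> ('a \<Rightarrow> 'b) \<Rightarrow> 'b measure \<Rightarrow> 'a measure" where
  "gen_by M X N = vimage_algebra (space M) X N"

definition cond_pr :: "'a measure \<Rightarrow> 'a measure \<Rightarrow> 'a set \<Rightarrow> 'a \<Rightarrow> real" where
  "cond_pr M G S = real_cond_exp M G (indicator S)"

definition cond_indep_var ::
  "'a measure \<Rightarrow> 'a measure \<Rightarrow> 'b measure \<Rightarrow> ('a \<Rightarrow> 'b) \<Rightarrow> 'c measure \<Rightarrow> ('a \<Rightarrow> 'c) \<Rightarrow> bool" where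
  "cond_indep_var M G N X L W \<longleftrightarrow>
     (\<forall>S \<in> sets N. \<forall>T \<in> sets L.
        AE x in M. cond_pr M G {y \<in> space M. X y \<in> S \<and> W y \<in> T} x =
                   cond_pr M G {y \<in> space M. X y \<in> S} x * cond_pr M G {y \<in> space M. W y \<in> T} x)"

text \<open>The Markov kernel \<open>K\<close> is a regular conditional distribution of \<open>W\<close> given \<open>V\<close>, so that
  \<open>cdf (K v) w\<close> is a version of \<open>F(w | v) = pr(W \<le> w | V = v)\<close>.\<close>

definition regular_cond_distr ::
  "'a measure \<Rightarrow> ('a \<Rightarrow> real) \<Rightarrow> ('a \<Rightarrow> real) \<Rightarrow> (real \<Rightarrow> real measure) \<Rightarrow> bool" where
  "regular_cond_distr M V W K \<longleftrightarrow>
     K \<in> borel \<rightarrow>\<^sub>M prob_algebra borel \<and>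
     (\<forall>S \<in> sets borel. AE x in M.
        measure (K (V x)) S = cond_pr M (gen_by M V borel) {y \<in> space M. W y \<in> S} x)"

text \<open>Non-negative distributional association of \<open>V\<close> on \<open>W\<close>, where \<open>K\<close> is the conditional
  distribution of \<open>W\<close> given \<open>V\<close>. In the differentiable case \<open>v\<close> ranges over an interval that
  carries \<open>V\<close>, with one-sided derivatives at endpoints belonging to it. In the discrete case the
  levels are the atoms of \<open>V\<close>. Finitely many levels lie between any two of them; without this,
  adjacent levels need not exist (think of atoms at all rationals) and differencing between them
  would say nothing.\<close>

definition nonneg_assoc_diff ::
  "'a measure \<Rightarrow> ('a \<Rightarrow> real) \<Rightarrow> (real \<Rightarrow> real measure) \<Rightarrow> bool" where
  "nonneg_assoc_diff M V K \<longleftrightarrow>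
     (\<exists>I. is_interval I \<and> (AE x in M. V x \<in> I) \<and>
        (\<forall>w. \<forall>v \<in> I. \<exists>D \<le> 0. ((\<lambda>u. cdf (K u) w) has_real_derivative D) (at v within I)))"

definition levels :: "'a measure \<Rightarrow> ('a \<Rightarrow> real) \<Rightarrow> real set" where
  "levels M V = {v. measure M {x \<in> space M. V x = v} > 0}"

definition nonneg_assoc_discrete ::
  "'a measure \<Rightarrow> ('a \<Rightarrow> real) \<Rightarrow> (real \<Rightarrow> real measure) \<Rightarrow> bool" where
  "nonneg_assoc_discrete M V K \<longleftrightarrow>
     (AE x in M. V x \<in> levels M V) \<and>
     (\<forall>a \<in> levels M V. \<forall>b \<in> levels M V. finite (levels M V \<inter> {a..b})) \<and>
     (\<forall>w. \<forall>v \<in> levels M V. \<forall>v' \<in> levels M V.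
        v < v' \<and> levels M V \<inter> {v<..<v'} = {} \<longrightarrow> cdf (K v') w - cdf (K v) w \<le> 0)"

definition nonneg_distr_assoc ::
  "'a measure \<Rightarrow> ('a \<Rightarrow> real) \<Rightarrow> (real \<Rightarrow> real measure) \<Rightarrow> bool" where
  "nonneg_distr_assoc M V K \<longleftrightarrow> nonneg_assoc_diff M V K \<or> nonneg_assoc_discrete M V K"

text \<open>\<open>arm M A a\<close> is the conditional probability measure given the event \<open>A = a\<close>.\<close>

definition arm :: "'a measure \<Rightarrow> ('a \<Rightarrow> real) \<Rightarrow> real \<Rightarrow> 'a measure" where
  "arm M A a = uniform_measure M {x \<in> space M. A x = a}"

definition ACE_true_arm ::
  "'a measure \<Rightarrow> ('a \<Rightarrow> real) \<Rightarrow> ('a \<Rightarrow> real) \<Rightarrow> ('a \<Rightarrow> real) \<Rightarrow> real \<Rightarrow> real" where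
  "ACE_true_arm M A Y1 Y0 a = (\<integral>x. Y1 x \<partial>arm M A a) - (\<integral>x. Y0 x \<partial>arm M A a)"

definition ACE_true :: "'a measure \<Rightarrow> ('a \<Rightarrow> real) \<Rightarrow> ('a \<Rightarrow> real) \<Rightarrow> real" where
  "ACE_true M Y1 Y0 = (\<integral>x. Y1 x \<partial>M) - (\<integral>x. Y0 x \<partial>M)"

definition ACE_unadj :: "'a measure \<Rightarrow> ('a \<Rightarrow> real) \<Rightarrow> ('a \<Rightarrow> real) \<Rightarrow> real" where
  "ACE_unadj M A Y = (\<integral>x. Y x \<partial>arm M A 1) - (\<integral>x. Y x \<partial>arm M A 0)"

text \<open>\<open>\<nu> a \<pi>\<close> is a version of \<open>E(Y | A = a, \<Pi> = \<pi>)\<close>.\<close>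

definition outcome_regression ::
  "'a measure \<Rightarrow> ('a \<Rightarrow> real) \<Rightarrow> ('a \<Rightarrow> real) \<Rightarrow> ('a \<Rightarrow> real) \<Rightarrow> (real \<Rightarrow> real \<Rightarrow> real) \<Rightarrow> bool" where
  "outcome_regression M A P Y \<nu> \<longleftrightarrow>
     \<nu> 0 \<in> borel_measurable borel \<and> \<nu> 1 \<in> borel_measurable borel \<and>
     (AE x in M. \<nu> (A x) (P x) = real_cond_exp M (gen_by M (\<lambda>x. (A x, P x)) borel) Y x)"

definition ACE1_adj ::
  "'a measure \<Rightarrow> ('a \<Rightarrow> real) \<Rightarrow> ('a \<Rightarrow> real) \<Rightarrow> ('a \<Rightarrow> real) \<Rightarrow> (real \<Rightarrow> real \<Rightarrow> real) \<Rightarrow> real" where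
  "ACE1_adj M A P Y \<nu> = (\<integral>x. Y x \<partial>arm M A 1) - (\<integral>\<pi>. \<nu> 0 \<pi> \<partial>distr (arm M A 1) borel P)"

definition ACE0_adj ::
  "'a measure \<Rightarrow> ('a \<Rightarrow> real) \<Rightarrow> ('a \<Rightarrow> real) \<Rightarrow> ('a \<Rightarrow> real) \<Rightarrow> (real \<Rightarrow> real \<Rightarrow> real) \<Rightarrow> real" where
  "ACE0_adj M A P Y \<nu> = (\<integral>\<pi>. \<nu> 1 \<pi> \<partial>distr (arm M A 0) borel P) - (\<integral>x. Y x \<partial>arm M A 0)"

definition ACE_adj ::
  "'a measure \<Rightarrow> ('a \<Rightarrow> real) \<Rightarrow> (real \<Rightarrow> real \<Rightarrow> real) \<Rightarrow> real" where
  "ACE_adj M P \<nu> = (\<integral>\<pi>. \<nu> 1 \<pi> \<partial>distr M borel P) - (\<integral>\<pi>. \<nu> 0 \<pi> \<partial>distr M borel P)"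

end

theory Submission
  imports Defs
begin

text \<open>Write \<open>W = \<delta>(Y(1)) + \<eta>(Y(0))\<close>, so that \<open>pr(A = 1 | \<Pi>, U) = \<Pi> + W\<close> with \<open>W\<close> bounded, of mean
  zero and independent of \<open>\<Pi>\<close>. With \<open>p = E \<Pi>\<close> and \<open>c\<^sub>a = E(Y(a) W)\<close> one computes
  \<open>\<nu>\<^sub>1(\<Pi>) = E Y(1) + c\<^sub>1 / \<Pi>\<close>, \<open>\<nu>\<^sub>0(\<Pi>) = E Y(0) - c\<^sub>0 / (1 - \<Pi>)\<close> and the
  unadjusted effect \<open>E Y(1) + c\<^sub>1 / p - E Y(0) + c\<^sub>0 / (1 - p)\<close>. Once \<open>c\<^sub>0, c\<^sub>1 \<ge> 0\<close>, the comparison with the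
  true effects is immediate and the comparison with the adjusted ones is Jensen's inequality
  for the reciprocal. Finally \<open>c\<^sub>1 \<ge> 0\<close> because \<open>\<delta>(Y(1))\<close> and, by stochastic monotonicity of \<open>Y(0)\<close>
  given \<open>Y(1)\<close>, also \<open>E(\<eta>(Y(0)) | Y(1))\<close> are non-decreasing in \<open>Y(1)\<close>, hence non-negatively
  correlated with it; likewise \<open>c\<^sub>0 \<ge> 0\<close>.\<close>

subsection \<open>Stochastic monotonicity\<close>

lemma integrable_mult_bounded:
  fixes f g :: "'a \<Rightarrow> real"
  assumes f: "integrable M f" and g: "g \<in> borel_measurable M" and bdd: "AE x in M. \<bar>g x\<bar> \<le> B"
  shows "integrable M (\<lambda>x. f x * g x)"
proof (rule Bochner_Integration.integrable_bound[where f="\<lambda>x. B * f x"])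
  show "AE x in M. norm (f x * g x) \<le> norm (B * f x)"
    using bdd
  proof eventually_elim
    case (elim x)
    then have "\<bar>f x\<bar> * \<bar>g x\<bar> \<le> \<bar>f x\<bar> * \<bar>B\<bar>"
      by (intro mult_left_mono) auto
    then show ?case by (simp add: abs_mult mult.commute)
  qed
qed (use f g in auto)

text \<open>A covariance inequality of Chebyshev type. Monotonicity and boundedness are asked only
  on a set \<open>I\<close> carrying \<open>V\<close>, since conditional distributions are ordered
  only on such a set.\<close>

lemma (in prob_space) expectation_centred_mult_mono_nonneg:
  fixes V :: "'a \<Rightarrow> real" and f :: "real \<Rightarrow> real"
  assumes V: "integrable M V" and I: "AE x in M. V x \<in> I"
    and f: "mono_on I f" and meas: "(\<lambda>x. f (V x)) \<in> borel_measurable M"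
    and bdd: "\<And>v. v \<in> I \<Longrightarrow> \<bar>f v\<bar> \<le> B"
  shows "0 \<le> (\<integral>x. (V x - expectation V) * f (V x) \<partial>M)"
proof -
  let ?m = "expectation V"
  \<comment> \<open>With \<open>c\<close> the value of \<open>f\<close> just left of the mean, the integrand of
    \<open>(V - E V) (f(V) - c)\<close> is pointwise non-negative.\<close>
  define S where "S = insert (-B) (f ` {v \<in> I. v \<le> ?m})"
  define c where "c = Sup S"
  have int: "integrable M (\<lambda>x. (V x - ?m) * f (V x))"
  proof (rule integrable_mult_bounded[where B=B])
    show "AE x in M. \<bar>f (V x)\<bar> \<le> B"
      using I by eventually_elim (rule bdd)
  qed (use V meas in auto)
  have "bdd_above S"
    unfolding S_def bdd_above_def
    by (rule exI[of _ "max B (-B)"]) (auto dest!: bdd)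
  have upper: "f v \<le> c" if "v \<in> I" "v \<le> ?m" for v
    unfolding c_def by (rule cSup_upper[OF _ \<open>bdd_above S\<close>]) (use that in \<open>auto simp: S_def\<close>)
  \<comment> \<open>The element \<open>-B\<close> keeps \<open>S\<close> nonempty even if
    \<open>I\<close> has no point up to the mean; being a lower bound of \<open>f\<close> on
    \<open>I\<close>, it does not spoil this inequality.\<close>
  have lower: "c \<le> f v" if "v \<in> I" "v > ?m" for v
    unfolding c_def
  proof (rule cSup_least)
    fix y assume "y \<in> S"
    then show "y \<le> f v"
      using that bdd[OF that(1)] mono_onD[OF f, of _ v] by (fastforce simp: S_def)
  qed (auto simp: S_def)
  have "0 \<le> (\<integral>x. (V x - ?m) * (f (V x) - c) \<partial>M)"
  proof (rule integral_nonneg_AE)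
    show "AE x in M. 0 \<le> (V x - ?m) * (f (V x) - c)"
      using I
    proof eventually_elim
      case (elim x)
      then show ?case
        using upper[of "V x"] lower[of "V x"]
        by (cases "V x \<le> ?m") (auto intro: mult_nonneg_nonneg mult_nonpos_nonpos)
    qed
  qed
  also have "\<dots> = (\<integral>x. (V x - ?m) * f (V x) - c * (V x - ?m) \<partial>M)"
    by (simp add: algebra_simps)
  also have "\<dots> = (\<integral>x. (V x - ?m) * f (V x) \<partial>M) - c * (\<integral>x. V x - ?m \<partial>M)"
    using int V by simp
  also have "(\<integral>x. V x - ?m \<partial>M) = 0"
    using V by (simp add: prob_space)
  finally show ?thesis by simp
qed

text \<open>The mean value theorem on \<open>{v..v'}\<close>, which lies in the interval
  \<open>I\<close>. Derivatives are taken at interior points; at the two ends continuity suffices,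
  so one-sided derivatives there do no harm.\<close>

lemma nonneg_assoc_diff_antimono:
  assumes "nonneg_assoc_diff M V K"
  obtains I where "AE x in M. V x \<in> I"
    "\<And>v v' w. v \<in> I \<Longrightarrow> v' \<in> I \<Longrightarrow> v \<le> v' \<Longrightarrow> cdf (K v') w \<le> cdf (K v) w"
proof -
  from assms obtain I where *: "is_interval I \<and> (AE x in M. V x \<in> I) \<and>
    (\<forall>w. \<forall>v \<in> I. \<exists>D \<le> 0. ((\<lambda>u. cdf (K u) w) has_real_derivative D) (at v within I))"
    unfolding nonneg_assoc_diff_def ..
  note I = *[THEN conjunct1] *[THEN conjunct2, THEN conjunct1]
    and D = *[THEN conjunct2, THEN conjunct2, rule_format]
  show thesis
  proof (rule that[OF I(2)])
    fix v v' w assume v: "v \<in> I" "v' \<in> I" "v \<le> v'"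
    have sub: "{v..v'} \<subseteq> I"
      using mem_is_interval_1_I[OF I(1) v(1,2)] by auto
    show "cdf (K v') w \<le> cdf (K v) w"
    proof (rule DERIV_nonpos_imp_decreasing_open[OF v(3)])
      fix x assume x: "v < x" "x < v'"
      then have "x \<in> I" using sub by auto
      from D[OF this, of w] obtain d
        where d: "d \<le> 0" "((\<lambda>u. cdf (K u) w) has_real_derivative d) (at x within I)"
        by blast
      \<comment> \<open>The derivative within \<open>I\<close> is a relative one; on an open
        interval it becomes an ordinary two-sided derivative.\<close>
      have "((\<lambda>u. cdf (K u) w) has_real_derivative d) (at x within {v<..<v'})"
        using d(2) by (rule DERIV_subset) (use sub in auto)
      then show "\<exists>y. ((\<lambda>u. cdf (K u) w) has_real_derivative y) (at x) \<and> y \<le> 0"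
        using x d(1) at_within_open[of x "{v<..<v'}"] by auto
    next
      have "continuous_on I (\<lambda>u. cdf (K u) w)"
        unfolding continuous_on_eq_continuous_within
      proof
        fix u assume "u \<in> I"
        from D[OF this, of w] show "continuous (at u within I) (\<lambda>u. cdf (K u) w)"
          by (blast intro: DERIV_continuous)
      qed
      then show "continuous_on {v..v'} (\<lambda>u. cdf (K u) w)"
        using sub by (rule continuous_on_subset)
    qed
  qed
qed

text \<open>Induction on the number of levels strictly between \<open>a\<close> and
  \<open>b\<close>: any such level splits the range into two with fewer, and with none left
  \<open>a\<close> and \<open>b\<close> are adjacent or equal.\<close>

lemma antimono_of_adjacent:
  fixes f :: "real \<Rightarrow> real"
  assumes "\<And>v v'. v \<in> L \<Longrightarrow> v' \<in> L \<Longrightarrow> v < v' \<Longrightarrow> L \<inter> {v<..<v'} = {} \<Longrightarrow> f v' \<le> f v"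
    and "finite (L \<inter> {a..b})" "a \<in> L" "b \<in> L" "a \<le> b"
  shows "f b \<le> f a"
  using assms(2-)
proof (induction "card (L \<inter> {a<..<b})" arbitrary: a b rule: less_induct)
  case less
  have fin: "finite (L \<inter> {a<..<b})"
    using less.prems(1) by (rule rev_finite_subset) auto
  show ?case
  proof (cases "L \<inter> {a<..<b} = {}")
    case True
    then show ?thesis using assms(1)[of a b] less.prems by (cases "a = b") auto
  next
    case False
    then obtain m where m: "m \<in> L" "a < m" "m < b" by auto
    have "card (L \<inter> {a<..<m}) < card (L \<inter> {a<..<b})" "card (L \<inter> {m<..<b}) < card (L \<inter> {a<..<b})"
      using m by (auto intro!: psubset_card_mono[OF fin])
    moreover have "finite (L \<inter> {a..m})" "finite (L \<inter> {m..b})"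
      using m by (auto intro!: rev_finite_subset[OF less.prems(1)])
    ultimately have "f m \<le> f a" "f b \<le> f m"
      using less.hyps[of a m] less.hyps[of m b] m less.prems by auto
    then show ?thesis by simp
  qed
qed

text \<open>Merges the differentiable and the discrete reading of association into the form used
  from here on: on a carrier of \<open>V\<close>, the conditional distributions increase
  stochastically with \<open>V\<close>.\<close>

lemma nonneg_distr_assoc_antimono:
  assumes "nonneg_distr_assoc M V K"
  obtains I where "AE x in M. V x \<in> I"
    "\<And>v v' w. v \<in> I \<Longrightarrow> v' \<in> I \<Longrightarrow> v \<le> v' \<Longrightarrow> cdf (K v') w \<le> cdf (K v) w"
proof (cases "nonneg_assoc_diff M V K")
  case True
  then show thesis by (rule nonneg_assoc_diff_antimono) (rule that)
next
  case False
  let ?L = "levels M V"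
  from False assms have V: "AE x in M. V x \<in> ?L"
    and fin: "\<And>a b. a \<in> ?L \<Longrightarrow> b \<in> ?L \<Longrightarrow> finite (?L \<inter> {a..b})"
    and adj: "\<And>w v v'. v \<in> ?L \<Longrightarrow> v' \<in> ?L \<Longrightarrow> v < v' \<Longrightarrow> ?L \<inter> {v<..<v'} = {}
      \<Longrightarrow> cdf (K v') w \<le> cdf (K v) w"
    by (auto simp: nonneg_distr_assoc_def nonneg_assoc_discrete_def)
  show thesis
  proof (rule that[OF V])
    fix v v' w assume "v \<in> ?L" "v' \<in> ?L" "v \<le> v'"
    then show "cdf (K v') w \<le> cdf (K v) w"
      using antimono_of_adjacent[of ?L "\<lambda>v. cdf (K v) w" v v'] adj fin by blast
  qed
qed

text \<open>An upward closed set of reals is empty, the whole line, an open ray or a closed ray. The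
  complement of an open ray is measured by the distribution function, that of a closed ray by its
  left limit, to which the pointwise order passes.\<close>

lemma measure_upward_closed_mono:
  fixes S :: "real set"
  assumes "real_distribution K" "real_distribution L"
    and cdf: "\<And>w. cdf L w \<le> cdf K w"
    and up: "\<And>s t. s \<in> S \<Longrightarrow> s \<le> t \<Longrightarrow> t \<in> S"
  shows "measure K S \<le> measure L S"
proof -
  interpret K: real_distribution K by fact
  interpret L: real_distribution L by fact
  consider "S = {}" | "S = UNIV" | t where "S = {t<..}" | t where "S = {t..}"
  proof -
    assume *: thesis if "S = {}" assume **: thesis if "S = UNIV"
    assume ***: thesis if "S = {t<..}" for t assume ****: thesis if "S = {t..}" for t
    show thesis
    proof (cases "S = {} \<or> \<not> bdd_below S")
      case True
      then show ?thesis
      proof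
        assume "S = {}"
        then show ?thesis by (rule *)
      next
        assume unbdd: "\<not> bdd_below S"
        have "x \<in> S" for x
        proof -
          obtain y where "y \<in> S" "\<not> x \<le> y"
            using unbdd unfolding bdd_below_def by blast
          then show ?thesis using up[of y x] by simp
        qed
        then have "S = UNIV" by blast
        then show ?thesis by (rule **)
      qed
    next
      case False
      have "t \<in> S" if "Inf S < t" for t
      proof -
        have "\<exists>y\<in>S. y < t"
          using that False by (subst (asm) cInf_less_iff) simp_all
        then obtain y where "y \<in> S" "y < t" ..
        then show ?thesis using up[of y t] by simp
      qed
      then have "{Inf S<..} \<subseteq> S" by blast
      moreover have "S \<subseteq> {Inf S..}"
        using False by (auto intro: cInf_lower)
      moreover have "{Inf S..} = insert (Inf S) {Inf S<..}" by auto
      ultimately have "S = {Inf S<..} \<or> S = {Inf S..}"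
        by (metis insert_subset subset_antisym subset_insert)
      then show ?thesis by (elim disjE) (rule ***, assumption, rule ****)
    qed
  qed
  then show ?thesis
  proof cases
    case 1
    then show ?thesis by simp
  next
    case 2
    then show ?thesis using K.prob_space L.prob_space by simp
  next
    case 3
    have "space K - {..t} = {t<..}" "space L - {..t} = {t<..}" by auto
    then show ?thesis
      using cdf[of t] K.prob_compl[of "{..t}"] L.prob_compl[of "{..t}"] 3
      by (simp add: cdf_def)
  next
    case 4
    have "space K - {..<t} = {t..}" "space L - {..<t} = {t..}" by auto
    moreover have "measure L {..<t} \<le> measure K {..<t}"
      by (rule tendsto_le[OF _ K.cdf_at_left L.cdf_at_left]) (auto simp: cdf)
    ultimately show ?thesis
      using K.prob_compl[of "{..<t}"] L.prob_compl[of "{..<t}"] 4 by simp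
  qed
qed

subsection \<open>Correlation under non-negative association\<close>

lemma subalgebra_gen_by: "X \<in> M \<rightarrow>\<^sub>M N \<Longrightarrow> subalgebra M (gen_by M X N)"
  using sets_image_in_sets[OF refl, of X M N] by (simp add: subalgebra_def gen_by_def)

lemma space_gen_by [simp]: "space (gen_by M X N) = space M"
  by (simp add: gen_by_def)

lemma measurable_gen_by: "X \<in> M \<rightarrow>\<^sub>M N \<Longrightarrow> X \<in> gen_by M X N \<rightarrow>\<^sub>M N"
  unfolding gen_by_def by (rule measurable_vimage_algebra1) (auto dest: measurable_space)

lemma (in prob_space) sigma_finite_subalgebra_of_subalgebra:
  "subalgebra M G \<Longrightarrow> sigma_finite_subalgebra M G"
  by (intro finite_measure_subalgebra_is_sigma_finite finite_measure_subalgebra.intro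
      finite_measure_subalgebra_axioms.intro) (rule finite_measure_axioms)

lemma (in prob_space) cond_pr_intg:
  assumes G: "subalgebra M G" and S: "S \<in> sets M"
    and f: "f \<in> borel_measurable G" "integrable M f"
  shows "integrable M (\<lambda>x. f x * cond_pr M G S x)"
    and "(\<integral>x. f x * cond_pr M G S x \<partial>M) = (\<integral>x. f x * indicator S x \<partial>M)"
proof -
  interpret sigma_finite_subalgebra M G
    using G by (rule sigma_finite_subalgebra_of_subalgebra)
  have "integrable M (\<lambda>x. f x * indicator S x)"
    using integrable_real_mult_indicator[OF S f(2)] .
  then show "integrable M (\<lambda>x. f x * cond_pr M G S x)"
    and "(\<integral>x. f x * cond_pr M G S x \<partial>M) = (\<integral>x. f x * indicator S x \<partial>M)"
    unfolding cond_pr_def using real_cond_exp_intg[of f "indicator S"] f(1) S by auto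
qed

lemma (in prob_space) cond_pr_bounds:
  assumes G: "subalgebra M G" and S: "S \<in> sets M"
  shows "AE x in M. 0 \<le> cond_pr M G S x \<and> cond_pr M G S x \<le> 1"
proof -
  interpret sigma_finite_subalgebra M G
    using G by (rule sigma_finite_subalgebra_of_subalgebra)
  have int: "integrable M (indicator S :: _ \<Rightarrow> real)"
    using S by (simp add: integrable_indicator_iff emeasure_eq_measure)
  have "AE x in M. 0 \<le> real_cond_exp M G (indicator S) x"
    by (rule real_cond_exp_pos) (use S in auto)
  moreover have "AE x in M. real_cond_exp M G (indicator S) x \<le> 1"
    by (rule real_cond_exp_le_c[OF int]) auto
  ultimately show ?thesis unfolding cond_pr_def by eventually_elim simp
qed

text \<open>The sum counts the positive integers not exceeding \<open>a\<close>. As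
  \<open>a \<le> real N\<close>, none is cut off, so it equals the floor of
  \<open>a\<close>.\<close>

lemma abs_diff_sum_of_bool_le:
  assumes "0 \<le> a" "a \<le> real N"
  shows "\<bar>a - (\<Sum>k<N. of_bool (real k + 1 \<le> a))\<bar> \<le> 1"
proof -
  have "{k \<in> {..<N}. real k + 1 \<le> a} = {..<nat \<lfloor>a\<rfloor>}"
    using assms by (auto simp: le_nat_floor nat_less_iff le_floor_iff less_floor_iff) linarith+
  then have "(\<Sum>k<N. of_bool (real k + 1 \<le> a)) = real (nat \<lfloor>a\<rfloor>)"
    by (simp add: of_bool_def sum.If_cases Int_def)
  also have "\<dots> = of_int \<lfloor>a\<rfloor>" using assms by simp
  finally show ?thesis by linarith
qed

text \<open>Passes from upward closed sets, where stochastic monotonicity applies directly, to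
  bounded non-decreasing functions through their superlevel sets (layer cake).\<close>

lemma integral_mult_mono_nonneg:
  fixes C W :: "'a \<Rightarrow> real" and h :: "real \<Rightarrow> real"
  assumes C: "integrable M C" "(\<integral>x. C x \<partial>M) = 0" and W: "W \<in> borel_measurable M"
    and upward: "\<And>S. S \<in> sets borel \<Longrightarrow> (\<And>s t. s \<in> S \<Longrightarrow> s \<le> t \<Longrightarrow> t \<in> S)
      \<Longrightarrow> 0 \<le> (\<integral>x. C x * indicator S (W x) \<partial>M)"
    and h: "mono h" "\<And>y. \<bar>h y\<bar> \<le> B"
  shows "0 \<le> (\<integral>x. C x * h (W x) \<partial>M)"
proof -
  have [measurable]: "h \<in> borel_measurable borel"
    using h(1) by (rule borel_measurable_mono)
  note [measurable] = W borel_measurable_integrable[OF C(1)]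
  have int: "integrable M (\<lambda>x. C x * h (W x))"
    by (rule integrable_mult_bounded[OF C(1), where B=B]) (use h(2) in auto)
  let ?I = "\<integral>x. C x * h (W x) \<partial>M"
  \<comment> \<open>Up to an error of at most 1, \<open>m (h + B)\<close> is a sum of indicators of upward closed sets.\<close>
  have bound: "0 \<le> real m * ?I + (\<integral>x. \<bar>C x\<bar> \<partial>M)" for m :: nat
  proof -
    define a where "a x = real m * (h (W x) + B)" for x
    \<comment> \<open>Since \<open>h + B\<close> lies between 0 and \<open>2 * B\<close>, this many
      unit steps cover the whole range of \<open>a\<close>.\<close>
    define N where "N = nat \<lceil>2 * real m * B\<rceil>"
    define S where "S k = {y. real k + 1 \<le> real m * (h y + B)}" for k :: nat
    define s where "s x = (\<Sum>k<N. indicator (S k) (W x) :: real)" for x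
    have [measurable]: "S k \<in> sets borel" for k
      unfolding S_def by measurable
    have S: "s \<in> S k \<Longrightarrow> s \<le> t \<Longrightarrow> t \<in> S k" for s t k
      using mult_left_mono[OF monoD[OF h(1)], of s t "real m"]
      by (auto simp: S_def distrib_left)
    have intS: "integrable M (\<lambda>x. C x * indicator (S k) (W x))" for k
      by (rule Bochner_Integration.integrable_bound[OF C(1)]) (auto simp: indicator_def)
    have "0 \<le> a x" "a x \<le> real N" for x
    proof -
      have "0 \<le> h (W x) + B" "h (W x) + B \<le> 2 * B" using h(2)[of "W x"] by linarith+
      then have "0 \<le> a x" "a x \<le> real m * (2 * B)"
        unfolding a_def by (auto intro: mult_left_mono)
      then show "0 \<le> a x" "a x \<le> real N" unfolding N_def by linarith+
    qed
    from abs_diff_sum_of_bool_le[OF this]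
    have approx: "\<bar>a x - s x\<bar> \<le> 1" for x
      by (simp add: a_def s_def S_def indicator_def of_bool_def)
    have "0 \<le> (\<Sum>k<N. \<integral>x. C x * indicator (S k) (W x) \<partial>M)"
      by (rule sum_nonneg, rule upward) (measurable, rule S)
    also have "\<dots> = (\<integral>x. C x * s x \<partial>M)"
      unfolding s_def sum_distrib_left
      by (rule Bochner_Integration.integral_sum[symmetric]) (rule intS)
    also have "\<dots> \<le> (\<integral>x. (real m * (C x * h (W x)) + real m * B * C x) + \<bar>C x\<bar> \<partial>M)"
    proof (rule integral_mono)
      show "integrable M (\<lambda>x. C x * s x)"
        unfolding s_def sum_distrib_left by (intro Bochner_Integration.integrable_sum intS)
      show "integrable M (\<lambda>x. (real m * (C x * h (W x)) + real m * B * C x) + \<bar>C x\<bar>)"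
        by (intro Bochner_Integration.integrable_add integrable_mult_right integrable_abs int C(1))
      fix x
      have "\<bar>C x\<bar> * \<bar>s x - a x\<bar> \<le> \<bar>C x\<bar>"
        using approx[of x] by (intro mult_left_le) (auto simp: abs_minus_commute)
      then have "C x * s x \<le> C x * a x + \<bar>C x\<bar>"
        unfolding abs_mult[symmetric] right_diff_distrib by linarith
      also have "C x * a x = real m * (C x * h (W x)) + real m * B * C x"
        by (simp only: a_def distrib_left distrib_right mult.left_commute mult.commute mult.assoc)
      finally show "C x * s x
        \<le> (real m * (C x * h (W x)) + real m * B * C x) + \<bar>C x\<bar>" .
    qed
    \<comment> \<open>The shift by \<open>B\<close> disappears because \<open>C\<close> has mean
      zero.\<close>
    also have "\<dots> = real m * ?I + (\<integral>x. \<bar>C x\<bar> \<partial>M)"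
      using int C by simp
    finally show ?thesis .
  qed
  \<comment> \<open>The error term is the same for every \<open>m\<close>, so a negative
    \<open>?I\<close> is refuted by a large \<open>m\<close>.\<close>
  show ?thesis
  proof (rule ccontr)
    assume "\<not> 0 \<le> ?I"
    then obtain m :: nat where "(\<integral>x. \<bar>C x\<bar> \<partial>M) < real m * (- ?I)"
      using reals_Archimedean3[of "- ?I"] by auto
    with bound[of m] show False by simp
  qed
qed

text \<open>Conditioning on \<open>V\<close> replaces the event \<open>W \<in> S\<close> by its
  kernel probability, which on a carrier of \<open>V\<close> is non-decreasing in \<open>V\<close>
  because \<open>S\<close> is upward closed. The covariance inequality for a function of
  \<open>V\<close> alone then applies.\<close>

lemma (in prob_space) assoc_upward_closed:
  assumes V: "integrable M V" and W: "W \<in> borel_measurable M"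
    and K: "regular_cond_distr M V W K" and assoc: "nonneg_distr_assoc M V K"
    and S: "S \<in> sets borel" "\<And>s t. s \<in> S \<Longrightarrow> s \<le> t \<Longrightarrow> t \<in> S"
  shows "0 \<le> (\<integral>x. (V x - expectation V) * indicator S (W x) \<partial>M)"
proof -
  note [measurable] = W borel_measurable_integrable[OF V] S(1)
  from K have K_meas: "K \<in> borel \<rightarrow>\<^sub>M prob_algebra borel"
    and K_eq: "AE x in M. measure (K (V x)) S = cond_pr M (gen_by M V borel) {y \<in> space M. W y \<in> S} x"
    using S(1) by (auto simp: regular_cond_distr_def)
  have K_distr: "real_distribution (K v)" for v
    using measurable_space[OF K_meas, of v]
    by (auto simp: space_prob_algebra real_distribution_def real_distribution_axioms_def)
  have K_S [measurable]: "(\<lambda>v. measure (K v) S) \<in> borel_measurable borel"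
    using measurable_compose[OF K_meas measurable_measure_prob_algebra[OF S(1)]] .
  obtain I where I: "AE x in M. V x \<in> I"
    and anti: "\<And>v v' w. v \<in> I \<Longrightarrow> v' \<in> I \<Longrightarrow> v \<le> v' \<Longrightarrow> cdf (K v') w \<le> cdf (K v) w"
    using nonneg_distr_assoc_antimono[OF assoc] by blast
  let ?G = "gen_by M V borel" and ?E = "{y \<in> space M. W y \<in> S}"
  have "(\<integral>x. (V x - expectation V) * indicator S (W x) \<partial>M)
      = (\<integral>x. (V x - expectation V) * indicator ?E x \<partial>M)"
    by (intro Bochner_Integration.integral_cong) (auto simp: indicator_def)
  also have "\<dots> = (\<integral>x. (V x - expectation V) * cond_pr M ?G ?E x \<partial>M)"
  proof (rule cond_pr_intg(2)[symmetric])
    have "V \<in> borel_measurable ?G" by (rule measurable_gen_by) measurable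
    then show "(\<lambda>x. V x - expectation V) \<in> borel_measurable ?G" by simp
  qed (use V in \<open>auto intro!: subalgebra_gen_by\<close>)
  also have "\<dots> = (\<integral>x. (V x - expectation V) * measure (K (V x)) S \<partial>M)"
  proof (rule integral_cong_AE)
    have "subalgebra M ?G" by (rule subalgebra_gen_by) measurable
    then have "cond_pr M ?G ?E \<in> borel_measurable M"
      unfolding cond_pr_def by (rule measurable_from_subalg) simp
    then show "(\<lambda>x. (V x - expectation V) * cond_pr M ?G ?E x) \<in> borel_measurable M" by simp
    show "AE x in M. (V x - expectation V) * cond_pr M ?G ?E x
        = (V x - expectation V) * measure (K (V x)) S"
      using K_eq by eventually_elim simp
  qed measurable
  also have "0 \<le> \<dots>"
  proof (rule expectation_centred_mult_mono_nonneg[OF V I, where B=1])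
    show "mono_on I (\<lambda>v. measure (K v) S)"
      by (intro mono_onI measure_upward_closed_mono[OF K_distr K_distr anti S(2)])
    show "\<bar>measure (K v) S\<bar> \<le> 1" for v
      using prob_space.prob_le_1[OF real_distribution.axioms(1)[OF K_distr]] by simp
  qed measurable
  finally show ?thesis .
qed

text \<open>Clamping is odd and does not increase distances, so the left side is the distance
  between the clamped values of \<open>a\<close> and \<open>-b\<close>.\<close>

lemma abs_clamp_add_le:
  fixes a b :: real
  assumes "0 \<le> n"
  shows "\<bar>max (-n) (min n a) + max (-n) (min n b)\<bar> \<le> \<bar>a + b\<bar>"
  using assms by (auto simp: max_def min_def)

text \<open>Stated for a generic pair: \<open>V = Y1\<close>, \<open>W = Y0\<close> gives the sign
  of \<open>c1\<close>, the exchanged pair that of \<open>c0\<close>. As the additive term is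
  centred, its product moment with \<open>V\<close> is a covariance.\<close>

lemma (in prob_space) expectation_mult_additive_nonneg:
  fixes V W :: "'a \<Rightarrow> real" and \<delta> \<eta> :: "real \<Rightarrow> real"
  assumes V: "integrable M V" and W: "W \<in> borel_measurable M"
    and K: "regular_cond_distr M V W K" and assoc: "nonneg_distr_assoc M V K"
    and mono: "mono \<delta>" "mono \<eta>"
    and bdd: "AE x in M. \<bar>\<delta> (V x) + \<eta> (W x)\<bar> \<le> B"
    and centred: "(\<integral>x. \<delta> (V x) + \<eta> (W x) \<partial>M) = 0"
  shows "0 \<le> (\<integral>x. V x * (\<delta> (V x) + \<eta> (W x)) \<partial>M)"
proof -
  note [measurable] = W borel_measurable_integrable[OF V]
    borel_measurable_mono[OF mono(1)] borel_measurable_mono[OF mono(2)]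
  let ?C = "\<lambda>x. V x - expectation V"
  let ?cl = "\<lambda>n::nat. \<lambda>y. max (- real n) (min (real n) y)"
  have C: "integrable M ?C" "(\<integral>x. ?C x \<partial>M) = 0"
    using V by (simp_all add: prob_space)
  \<comment> \<open>\<open>\<delta>(V)\<close> and \<open>\<eta>(W)\<close> need not be integrable separately, so both are clamped to \<open>[-n, n]\<close>;
    the sum of the clamped terms is still dominated by \<open>\<bar>\<delta>(V) + \<eta>(W)\<bar>\<close>.\<close>
  have int_cl: "integrable M (\<lambda>x. ?C x * ?cl n (f x))" if [measurable]: "f \<in> borel_measurable M" for f n
    by (rule integrable_mult_bounded[OF C(1), where B="real n"]) auto
  have "0 \<le> (\<integral>x. ?C x * (?cl n (\<delta> (V x)) + ?cl n (\<eta> (W x))) \<partial>M)" for n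
  proof -
    have "mono (\<lambda>y. ?cl n (\<delta> y))" "mono (\<lambda>y. ?cl n (\<eta> y))"
      using mono by (auto intro!: monoI max.mono min.mono dest: monoD)
    \<comment> \<open>The first term is a function of \<open>V\<close> alone; the second depends on
      \<open>W\<close> and needs the association, by way of upward closed sets.\<close>
    then have "0 \<le> (\<integral>x. ?C x * ?cl n (\<delta> (V x)) \<partial>M)" "0 \<le> (\<integral>x. ?C x * ?cl n (\<eta> (W x)) \<partial>M)"
      by (auto intro!: expectation_centred_mult_mono_nonneg[OF V, where I=UNIV and B="real n"]
          integral_mult_mono_nonneg[OF C W assoc_upward_closed[OF V W K assoc], where B="real n"])
    then show ?thesis
      by (simp add: distrib_left int_cl)
  qed
  moreover have "(\<lambda>n. \<integral>x. ?C x * (?cl n (\<delta> (V x)) + ?cl n (\<eta> (W x))) \<partial>M)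
    \<longlonglongrightarrow> (\<integral>x. ?C x * (\<delta> (V x) + \<eta> (W x)) \<partial>M)"
  proof (rule integral_dominated_convergence[where w="\<lambda>x. B * \<bar>?C x\<bar>"])
    show "integrable M (\<lambda>x. B * \<bar>?C x\<bar>)" using C by simp
    have lim: "(\<lambda>n. ?cl n y) \<longlonglongrightarrow> y" for y
    proof (rule tendsto_eventually)
      have "\<forall>\<^sub>F n in sequentially. \<bar>y\<bar> \<le> real n"
        by (rule eventually_sequentiallyI[of "nat \<lceil>\<bar>y\<bar>\<rceil>"]) linarith
      then show "\<forall>\<^sub>F n in sequentially. ?cl n y = y"
        by eventually_elim auto
    qed
    show "AE x in M. (\<lambda>n. ?C x * (?cl n (\<delta> (V x)) + ?cl n (\<eta> (W x))))
        \<longlonglongrightarrow> ?C x * (\<delta> (V x) + \<eta> (W x))"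
      by (intro AE_I2 tendsto_intros lim)
    show "AE x in M. norm (?C x * (?cl n (\<delta> (V x)) + ?cl n (\<eta> (W x)))) \<le> B * \<bar>?C x\<bar>" for n
      using bdd
    proof eventually_elim
      case (elim x)
      then have "\<bar>?cl n (\<delta> (V x)) + ?cl n (\<eta> (W x))\<bar> \<le> B"
        by (intro order.trans[OF abs_clamp_add_le]) auto
      from mult_left_mono[OF this abs_ge_zero[of "?C x"]] show ?case
        by (simp only: abs_mult real_norm_def mult.commute)
    qed
  qed measurable
  ultimately have "0 \<le> (\<integral>x. ?C x * (\<delta> (V x) + \<eta> (W x)) \<partial>M)"
    by (intro LIMSEQ_le_const) auto
  also have "\<dots> = (\<integral>x. V x * (\<delta> (V x) + \<eta> (W x)) - expectation V * (\<delta> (V x) + \<eta> (W x)) \<partial>M)"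
    by (simp add: left_diff_distrib)
  also have "\<dots> = (\<integral>x. V x * (\<delta> (V x) + \<eta> (W x)) \<partial>M)
      - expectation V * (\<integral>x. \<delta> (V x) + \<eta> (W x) \<partial>M)"
  proof (subst Bochner_Integration.integral_diff)
    have int: "integrable M (\<lambda>x. \<delta> (V x) + \<eta> (W x))"
      using bdd by (intro integrable_const_bound[where B=B]) auto
    show "integrable M (\<lambda>x. expectation V * (\<delta> (V x) + \<eta> (W x)))"
      using int by simp
    show "integrable M (\<lambda>x. V x * (\<delta> (V x) + \<eta> (W x)))"
      by (rule integrable_mult_bounded[OF V _ bdd]) measurable
  qed simp
  finally show ?thesis using centred by simp
qed

subsection \<open>Arms and regression\<close>

text \<open>Independence of two sigma-algebras is inherited by the smaller ones that
  \<open>f\<close> and \<open>g\<close> generate, which makes \<open>f\<close> and \<open>g\<close>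
  independent variables.\<close>

lemma (in prob_space) indep_set_expectation_mult:
  fixes f g :: "'a \<Rightarrow> real"
  assumes indep: "indep_set (sets F) (sets G)" and sp: "space F = space M" "space G = space M"
    and f: "f \<in> borel_measurable F" "integrable M f"
    and g: "g \<in> borel_measurable G" "integrable M g"
  shows "(\<integral>x. f x * g x \<partial>M) = expectation f * expectation g"
proof (rule indep_var_lebesgue_integral[OF _ f(2) g(2)])
  have sub: "sigma_sets (space M) {X -` A \<inter> space M |A. A \<in> sets borel} \<subseteq> sets H"
    if "X \<in> borel_measurable H" "space H = space M" for X :: "'a \<Rightarrow> real" and H :: "'a measure"
    using that measurable_sets[OF that(1)] sets.top[of H]
    by (intro sets.sigma_sets_subset') auto
  have "indep_set (sigma_sets (space M) {f -` A \<inter> space M |A. A \<in> sets borel})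
      (sigma_sets (space M) {g -` A \<inter> space M |A. A \<in> sets borel})"
    using indep unfolding indep_set_def
    by (rule indep_sets_mono_sets) (auto split: bool.split dest: sub[OF f(1) sp(1), THEN subsetD]
        sub[OF g(1) sp(2), THEN subsetD])
  then show "indep_var borel f borel g"
    using f(2) g(2) by (simp add: indep_var_eq)
qed

lemma (in prob_space) integral_arm:
  fixes f :: "'a \<Rightarrow> real"
  assumes [measurable]: "A \<in> borel_measurable M" "f \<in> borel_measurable M"
    and pos: "0 < prob {x \<in> space M. A x = a}"
  shows "(\<integral>x. f x \<partial>arm M A a)
    = (\<integral>x. indicator {x \<in> space M. A x = a} x * f x \<partial>M) / prob {x \<in> space M. A x = a}"
proof -
  let ?S = "{x \<in> space M. A x = a}"
  have S: "?S \<in> sets M" by measurable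
  have "uniform_measure M ?S = density M (\<lambda>x. ennreal (indicator ?S x / prob ?S))"
    unfolding uniform_measure_def emeasure_eq_measure
    using pos by (simp add: divide_ennreal[symmetric] flip: ennreal_indicator)
  then have "(\<integral>x. f x \<partial>arm M A a) = (\<integral>x. (indicator ?S x / prob ?S) * f x \<partial>M)"
    unfolding arm_def using S by (simp add: integral_density)
  also have "\<dots> = (\<integral>x. (indicator ?S x * f x) / prob ?S \<partial>M)"
    by (simp add: divide_simps)
  finally show ?thesis by simp
qed

lemma (in prob_space) expectation_reciprocal_ge:
  fixes Q X :: "'a \<Rightarrow> real"
  assumes X: "integrable M X" and Q: "integrable M Q" "AE x in M. 0 < Q x"
    and mean: "0 < expectation Q"
    and eq: "AE x in M. X x = m + r / Q x" and r: "0 \<le> r"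
  shows "m + r / expectation Q \<le> expectation X"
proof -
  let ?q = "expectation Q"
  \<comment> \<open>Jensen via the tangent of the reciprocal at \<open>E Q\<close>, so that \<open>1 / Q\<close> need not be integrable.\<close>
  have "m + r / ?q = (\<integral>x. (m + 2 * r / ?q) - r / ?q\<^sup>2 * Q x \<partial>M)"
    using Q mean by (simp add: prob_space power2_eq_square field_simps)
  also have "\<dots> \<le> expectation X"
  proof (rule integral_mono_AE[OF _ X])
    show "AE x in M. (m + 2 * r / ?q) - r / ?q\<^sup>2 * Q x \<le> X x"
      using Q(2) eq
    proof eventually_elim
      case (elim x)
      \<comment> \<open>Up to the factor \<open>r\<close>, this is the gap between
        \<open>1 / Q\<close> and its tangent at the mean.\<close>
      have "0 \<le> r * ((Q x - ?q)\<^sup>2 / (?q\<^sup>2 * Q x))"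
        using r elim(1) mean by simp
      also have "\<dots> = r / Q x - (2 * r / ?q - r / ?q\<^sup>2 * Q x)"
        using elim(1) mean by (simp add: power2_eq_square field_simps)
      finally show ?case using elim(2) by simp
    qed
  qed (use Q in simp)
  finally show ?thesis .
qed

text \<open>Serves both arms: \<open>J\<close> is the indicator of arm \<open>a\<close>,
  \<open>q\<close> its propensity as a function of \<open>P\<close>, and \<open>y\<close> the
  potential outcome seen there. The moment identities \<open>J_n\<close> and \<open>J_y\<close> over
  sets of propensities force \<open>q * \<nu> a = q * m + r\<close>, which can be divided by
  \<open>q > 0\<close>.\<close>

lemma (in prob_space) arm_regression:
  fixes A P Y y J :: "'a \<Rightarrow> real" and q :: "real \<Rightarrow> real" and \<nu> :: "real \<Rightarrow> real \<Rightarrow> real"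
  assumes A: "A \<in> borel_measurable M" and P: "P \<in> borel_measurable M"
    and n: "\<nu> a \<in> borel_measurable borel" "integrable M (\<lambda>x. \<nu> a (P x))"
    and Y: "integrable M Y"
    and reg: "AE x in M. \<nu> (A x) (P x) = real_cond_exp M (gen_by M (\<lambda>x. (A x, P x)) borel) Y x"
    and J: "\<And>x. x \<in> space M \<Longrightarrow> J x = of_bool (A x = a)"
    and Y_eq: "\<And>x. x \<in> space M \<Longrightarrow> A x = a \<Longrightarrow> Y x = y x"
    and q: "q \<in> borel_measurable borel" "AE x in M. 0 < q (P x) \<and> q (P x) < 1"
    and J_n: "\<And>B. B \<in> sets borel \<Longrightarrow> (\<integral>x. J x * (indicator B (P x) * \<nu> a (P x)) \<partial>M)
      = (\<integral>x. q (P x) * (indicator B (P x) * \<nu> a (P x)) \<partial>M)"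
    and J_y: "\<And>B. B \<in> sets borel \<Longrightarrow> (\<integral>x. J x * (indicator B (P x) * y x) \<partial>M)
      = (\<integral>x. indicator B (P x) * q (P x) \<partial>M) * m + (\<integral>x. indicator B (P x) \<partial>M) * r"
  shows "AE x in M. \<nu> a (P x) = m + r / q (P x)"
    and "(\<integral>x. J x * \<nu> a (P x) \<partial>M) = (\<integral>x. q (P x) \<partial>M) * m + r"
proof -
  note [measurable] = A P n(1) q(1) borel_measurable_integrable[OF Y]
  let ?X = "\<lambda>x. (A x, P x)"
  let ?G = "gen_by M ?X borel"
  have X: "?X \<in> M \<rightarrow>\<^sub>M borel" by measurable
  interpret G: sigma_finite_subalgebra M ?G
    using subalgebra_gen_by[OF X] by (rule sigma_finite_subalgebra_of_subalgebra)
  have J_meas [measurable]: "J \<in> borel_measurable M"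
    by (subst measurable_cong[OF J]) auto
  have q_bdd: "AE x in M. \<bar>q (P x)\<bar> \<le> 1"
    using q(2) by eventually_elim auto
  have int_q: "integrable M (\<lambda>x. q (P x))"
    using q_bdd by (intro integrable_const_bound[where B=1]) auto
  have int_qn: "integrable M (\<lambda>x. q (P x) * \<nu> a (P x))"
    using integrable_mult_bounded[OF n(2) _ q_bdd] by (simp add: mult.commute)
  have tower: "(\<integral>x. J x * (indicator B (P x) * \<nu> a (P x)) \<partial>M)
      = (\<integral>x. J x * (indicator B (P x) * y x) \<partial>M)" if [measurable]: "B \<in> sets borel" for B
  proof -
    \<comment> \<open>This test function depends on \<open>(A, P)\<close> only, so the regression
      may be exchanged for \<open>Y\<close>, which on arm \<open>a\<close> is
      \<open>y\<close>.\<close>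
    let ?f = "\<lambda>x. of_bool (A x = a) * indicator B (P x) :: real"
    have "(\<lambda>z. of_bool (fst z = a) * indicator B (snd z) :: real) \<in> borel_measurable (borel :: (real \<times> real) measure)"
      unfolding borel_prod[symmetric] by measurable
    from measurable_compose[OF measurable_gen_by[OF X] this]
    have f: "?f \<in> borel_measurable ?G" by simp
    have int: "integrable M (\<lambda>x. ?f x * Y x)"
      using integrable_mult_bounded[OF Y, of ?f 1] by (auto simp: mult.commute indicator_def)
    have "(\<integral>x. J x * (indicator B (P x) * \<nu> a (P x)) \<partial>M)
        = (\<integral>x. ?f x * real_cond_exp M ?G Y x \<partial>M)"
    proof (rule integral_cong_AE)
      show "AE x in M. J x * (indicator B (P x) * \<nu> a (P x)) = ?f x * real_cond_exp M ?G Y x"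
        using reg AE_space by eventually_elim (auto simp: J)
      show "(\<lambda>x. ?f x * real_cond_exp M ?G Y x) \<in> borel_measurable M"
        using measurable_from_subalg[OF subalgebra_gen_by[OF X] f] by simp
    qed measurable
    also have "\<dots> = (\<integral>x. ?f x * Y x \<partial>M)"
      using int f by (rule G.real_cond_exp_intg(2)) measurable
    also have "\<dots> = (\<integral>x. J x * (indicator B (P x) * y x) \<partial>M)"
      by (intro Bochner_Integration.integral_cong) (auto simp: J Y_eq)
    finally show ?thesis .
  qed
  \<comment> \<open>Both sides have equal integrals over every Borel set under the law of
    \<open>P\<close>, and integrals over sets determine an integrable function almost
    everywhere.\<close>
  have "AE \<pi> in distr M borel P. q \<pi> * \<nu> a \<pi> = q \<pi> * m + r"
  proof (rule density_unique_real)
    show "integrable (distr M borel P) (\<lambda>\<pi>. q \<pi> * \<nu> a \<pi>)"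
      using int_qn by (simp add: integrable_distr_eq)
    show "integrable (distr M borel P) (\<lambda>\<pi>. q \<pi> * m + r)"
      using int_q by (simp add: integrable_distr_eq)
    fix B assume "B \<in> sets (distr M borel P)"
    then have [measurable]: "B \<in> sets borel" by simp
    have int_Bq: "integrable M (\<lambda>x. indicator B (P x) * q (P x))"
      by (rule Bochner_Integration.integrable_bound[OF int_q]) (auto simp: indicator_def)
    have int_B: "integrable M (\<lambda>x. indicator B (P x) :: real)"
      by (rule integrable_const_bound[where B=1]) (auto simp: indicator_def)
    have "(\<integral>\<pi>\<in>B. q \<pi> * \<nu> a \<pi> \<partial>distr M borel P)
        = (\<integral>x. q (P x) * (indicator B (P x) * \<nu> a (P x)) \<partial>M)"
      unfolding set_lebesgue_integral_def by (subst integral_distr) (auto simp: ac_simps)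
    also have "\<dots> = (\<integral>x. indicator B (P x) * q (P x) \<partial>M) * m + (\<integral>x. indicator B (P x) \<partial>M) * r"
      by (simp add: J_n[symmetric] tower J_y)
    also have "\<dots> = (\<integral>x. indicator B (P x) * q (P x) * m + indicator B (P x) * r \<partial>M)"
      using int_Bq int_B by (subst Bochner_Integration.integral_add) simp_all
    also have "\<dots> = (\<integral>\<pi>\<in>B. q \<pi> * m + r \<partial>distr M borel P)"
      unfolding set_lebesgue_integral_def by (subst integral_distr) (auto simp: algebra_simps)
    finally show "(\<integral>\<pi>\<in>B. q \<pi> * \<nu> a \<pi> \<partial>distr M borel P) = (\<integral>\<pi>\<in>B. q \<pi> * m + r \<partial>distr M borel P)" .
  qed
  then have "AE x in M. q (P x) * \<nu> a (P x) = q (P x) * m + r"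
    by (subst (asm) AE_distr_iff) auto
  then show "AE x in M. \<nu> a (P x) = m + r / q (P x)"
    using q(2) by eventually_elim (simp add: field_simps)
  show "(\<integral>x. J x * \<nu> a (P x) \<partial>M) = (\<integral>x. q (P x) \<partial>M) * m + r"
    using tower[of UNIV] J_y[of UNIV] by (simp add: prob_space)
qed

subsection \<open>The causal comparison\<close>

theorem theorem5:
  fixes M :: "'a measure" and N :: "'z measure"
    and Z :: "'a \<Rightarrow> 'z" and A Y Y1 Y0 P :: "'a \<Rightarrow> real"
    and \<delta> \<eta> :: "real \<Rightarrow> real" and \<nu> :: "real \<Rightarrow> real \<Rightarrow> real"
    and K1 K0 :: "real \<Rightarrow> real measure"
  assumes "prob_space M"
    and "Z \<in> M \<rightarrow>\<^sub>M N"
    and "A \<in> borel_measurable M" and "\<And>x. x \<in> space M \<Longrightarrow> A x \<in> {0, 1}"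
    and "Y1 \<in> borel_measurable M" and "Y0 \<in> borel_measurable M"
    and "\<And>x. x \<in> space M \<Longrightarrow> Y x = A x * Y1 x + (1 - A x) * Y0 x"
    and propensity: "P \<in> borel_measurable (gen_by M Z N)"
      "AE x in M. P x = cond_pr M (gen_by M Z N) {y \<in> space M. A y = 1} x"
    and overlap: "AE x in M. 0 < P x \<and> P x < 1"
    and Z_indep_U: "prob_space.indep_set M (sets (gen_by M Z N))
      (sets (gen_by M (\<lambda>x. (Y1 x, Y0 x)) borel))"
    and A_cond_indep_Z:
      "cond_indep_var M (gen_by M (\<lambda>x. (P x, Y1 x, Y0 x)) borel) borel A N Z"
    and "integrable M Y1" and "integrable M Y0"
    and "outcome_regression M A P Y \<nu>"
    and "integrable (distr M borel P) (\<nu> 1)" and "integrable (distr M borel P) (\<nu> 0)"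
    and a: "mono \<delta>" "mono \<eta>"
      "AE x in M. cond_pr M (gen_by M (\<lambda>x. (P x, Y1 x, Y0 x)) borel) {y \<in> space M. A y = 1} x
                  = P x + \<delta> (Y1 x) + \<eta> (Y0 x)"
    and "regular_cond_distr M Y0 Y1 K1" and "regular_cond_distr M Y1 Y0 K0"
    and b: "nonneg_distr_assoc M Y0 K1" "nonneg_distr_assoc M Y1 K0"
    and c: "\<exists>s. AE x in M. esssup (K1 (Y0 x)) ereal = s"
      "\<exists>s. AE x in M. esssup (K0 (Y1 x)) ereal = s"
  shows "(ACE1_adj M A P Y \<nu> \<ge> ACE_unadj M A Y \<and> ACE_unadj M A Y \<ge> ACE_true_arm M A Y1 Y0 1) \<and>
         (ACE0_adj M A P Y \<nu> \<ge> ACE_unadj M A Y \<and> ACE_unadj M A Y \<ge> ACE_true_arm M A Y1 Y0 0) \<and>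
         (ACE_adj M P \<nu> \<ge> ACE_unadj M A Y \<and> ACE_unadj M A Y \<ge> ACE_true M Y1 Y0)"
proof -

  \<comment> \<open>Measurability, boundedness and integrability of the data\<close>
  interpret prob_space M by fact
  note Z = assms(2) and A = assms(3) and A01 = assms(4) and Y1 = assms(5) and Y0 = assms(6)
    and Y = assms(7) and intY1 = assms(13) and intY0 = assms(14) and reg = assms(15)
    and int\<nu>1 = assms(16) and int\<nu>0 = assms(17)
    and K1 = assms(21) and K0 = assms(22)
  have P [measurable]: "P \<in> borel_measurable M"
    using measurable_from_subalg[OF subalgebra_gen_by[OF Z] propensity(1)] .
  note [measurable] = A Y1 Y0 borel_measurable_mono[OF a(1)] borel_measurable_mono[OF a(2)]
  have \<nu> [measurable]: "\<nu> 1 \<in> borel_measurable borel" "\<nu> 0 \<in> borel_measurable borel"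
    and \<nu>_eq: "AE x in M. \<nu> (A x) (P x) = real_cond_exp M (gen_by M (\<lambda>x. (A x, P x)) borel) Y x"
    using reg by (auto simp: outcome_regression_def)
  have int\<nu>: "integrable M (\<lambda>x. \<nu> 1 (P x))" "integrable M (\<lambda>x. \<nu> 0 (P x))"
    using int\<nu>1 int\<nu>0 by (simp_all add: integrable_distr_eq)
  have Y_meas [measurable]: "Y \<in> borel_measurable M"
    by (subst measurable_cong[OF Y]) measurable
  let ?S = "\<lambda>a. {x \<in> space M. A x = a}"
  have S [measurable]: "?S a \<in> sets M" for a by measurable
  have ind1: "indicator (?S 1) x = A x" and ind0: "indicator (?S 0) x = 1 - A x" if "x \<in> space M" for x
    using A01[OF that] that by (auto simp: indicator_def)
  have A_bdd: "AE x in M. \<bar>A x\<bar> \<le> 1" "AE x in M. \<bar>1 - A x\<bar> \<le> 1"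
    using A01 by (fastforce intro: AE_I2)+
  have P_bdd: "AE x in M. \<bar>P x\<bar> \<le> 1"
    using overlap by eventually_elim auto
  have int_A: "integrable M A" and int_P: "integrable M P"
    using A_bdd P_bdd by (auto intro!: integrable_const_bound[where B=1])
  have int_Y: "integrable M Y"
  proof -
    have "integrable M (\<lambda>x. Y1 x * A x + Y0 x * (1 - A x))"
      by (intro Bochner_Integration.integrable_add integrable_mult_bounded[OF intY1 _ A_bdd(1)]
          integrable_mult_bounded[OF intY0 _ A_bdd(2)]) measurable
    then show ?thesis
      by (subst Bochner_Integration.integrable_cong[OF refl Y]) (simp_all add: mult.commute)
  qed

  \<comment> \<open>Replacing the treatment by its conditional probabilities\<close>
  let ?X = "\<lambda>x. (P x, Y1 x, Y0 x)" and ?U = "\<lambda>x. (Y1 x, Y0 x)"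
  have X: "?X \<in> M \<rightarrow>\<^sub>M borel" and U: "?U \<in> M \<rightarrow>\<^sub>M borel" by measurable
  have X_comp: "(\<lambda>x. f (?X x)) \<in> borel_measurable (gen_by M ?X borel)"
    if "f \<in> borel_measurable (borel \<Otimes>\<^sub>M borel \<Otimes>\<^sub>M borel)" for f :: "real \<times> real \<times> real \<Rightarrow> real"
    using measurable_compose[OF measurable_gen_by[OF X], of f borel] that by (simp add: borel_prod)
  have U_comp: "(\<lambda>x. f (?U x)) \<in> borel_measurable (gen_by M ?U borel)"
    if "f \<in> borel_measurable (borel \<Otimes>\<^sub>M borel)" for f :: "real \<times> real \<Rightarrow> real"
    using measurable_compose[OF measurable_gen_by[OF U], of f borel] that by (simp add: borel_prod)

  define W where "W x = \<delta> (Y1 x) + \<eta> (Y0 x)" for x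
  have W_meas [measurable]: "W \<in> borel_measurable M"
    unfolding W_def by measurable
  \<comment> \<open>Both \<open>P\<close> and \<open>P + W\<close> are probabilities, so they differ
    by at most 1.\<close>
  have W_bdd: "AE x in M. \<bar>W x\<bar> \<le> 1"
    using cond_pr_bounds[OF subalgebra_gen_by[OF X] S[of 1]] a(3) overlap
    by eventually_elim (auto simp: W_def)
  have int_W: "integrable M W"
    using W_bdd by (intro integrable_const_bound[where B=1]) auto
  \<comment> \<open>Against functions of \<open>Z\<close> the treatment averages to
    \<open>P\<close>; against functions of \<open>(P, Y1, Y0)\<close> it averages to
    \<open>P + W\<close>, as shown next.\<close>
  have A_to_P: "(\<integral>x. A x * f x \<partial>M) = (\<integral>x. P x * f x \<partial>M)"
    if f: "f \<in> borel_measurable (gen_by M Z N)" "integrable M f" for f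
  proof -
    have "(\<integral>x. A x * f x \<partial>M) = (\<integral>x. f x * indicator (?S 1) x \<partial>M)"
      by (intro Bochner_Integration.integral_cong) (simp_all add: ind1 mult.commute)
    also have "\<dots> = (\<integral>x. f x * cond_pr M (gen_by M Z N) (?S 1) x \<partial>M)"
      using f by (rule cond_pr_intg(2)[OF subalgebra_gen_by[OF Z] S, symmetric])
    also have "\<dots> = (\<integral>x. P x * f x \<partial>M)"
    proof (rule integral_cong_AE)
      show "AE x in M. f x * cond_pr M (gen_by M Z N) (?S 1) x = P x * f x"
        using propensity(2) by eventually_elim simp
    qed (use cond_pr_intg(1)[OF subalgebra_gen_by[OF Z] S f] f(2) in auto)
    finally show ?thesis .
  qed
  have A_to_PW: "(\<integral>x. A x * f x \<partial>M) = (\<integral>x. f x * (P x + W x) \<partial>M)"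
    if f: "f \<in> borel_measurable (gen_by M ?X borel)" "integrable M f" for f
  proof -
    have "(\<integral>x. A x * f x \<partial>M) = (\<integral>x. f x * indicator (?S 1) x \<partial>M)"
      by (intro Bochner_Integration.integral_cong) (simp_all add: ind1 mult.commute)
    also have "\<dots> = (\<integral>x. f x * cond_pr M (gen_by M ?X borel) (?S 1) x \<partial>M)"
      using f by (rule cond_pr_intg(2)[OF subalgebra_gen_by[OF X] S, symmetric])
    also have "\<dots> = (\<integral>x. f x * (P x + W x) \<partial>M)"
    proof (rule integral_cong_AE)
      show "AE x in M. f x * cond_pr M (gen_by M ?X borel) (?S 1) x = f x * (P x + W x)"
        using a(3) by eventually_elim (simp add: W_def)
    qed (use cond_pr_intg(1)[OF subalgebra_gen_by[OF X] S f] f(2) in auto)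
    finally show ?thesis .
  qed
  define p where "p = expectation P"
  have one: "(\<lambda>_. 1::real) \<in> borel_measurable F" "integrable M (\<lambda>_. 1::real)" for F :: "'a measure"
    by simp_all
  have EA: "expectation A = p"
    using A_to_P[OF one] by (simp only: p_def mult_1_right)
  \<comment> \<open>The probability of treatment is computed twice, given \<open>Z\<close> and given
    \<open>(P, Y1, Y0)\<close>, with the constant test function 1.\<close>
  have W_centred: "expectation W = 0"
  proof -
    have "p = (\<integral>x. P x + W x \<partial>M)"
      using A_to_PW[OF one] by (simp only: EA mult_1_right mult_1_left)
    also have "\<dots> = p + expectation W"
      unfolding p_def using int_P int_W by (rule Bochner_Integration.integral_add)
    finally show ?thesis by simp
  qed
  have p: "0 < p" "p < 1"
  proof -
    have "AE x in M. 0 < P x" "AE x in M. P x < 1"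
      using overlap by auto
    then show "0 < p" "p < 1"
      unfolding p_def
      using integral_less_AE_space[of "\<lambda>_. 0" P] expectation_less[OF int_P] int_P
      by (simp_all add: emeasure_space_1)
  qed

  \<comment> \<open>Signs of the moments \<open>c1\<close> and \<open>c0\<close>\<close>
  define m1 where "m1 = expectation Y1"
  define m0 where "m0 = expectation Y0"
  define c1 where "c1 = expectation (\<lambda>x. Y1 x * W x)"
  define c0 where "c0 = expectation (\<lambda>x. Y0 x * W x)"
  \<comment> \<open>Both orders of the sum are recorded because the covariance inequality is applied
    with \<open>Y1\<close> and \<open>Y0\<close> in either role.\<close>
  have sum_bdd: "AE x in M. \<bar>\<delta> (Y1 x) + \<eta> (Y0 x)\<bar> \<le> 1" "AE x in M. \<bar>\<eta> (Y0 x) + \<delta> (Y1 x)\<bar> \<le> 1"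
    using W_bdd by (simp_all only: W_def add.commute)
  have sum_centred: "(\<integral>x. \<delta> (Y1 x) + \<eta> (Y0 x) \<partial>M) = 0" "(\<integral>x. \<eta> (Y0 x) + \<delta> (Y1 x) \<partial>M) = 0"
    using W_centred unfolding W_def[abs_def] by (simp_all only: add.commute)
  have c1: "0 \<le> c1"
    using expectation_mult_additive_nonneg[OF intY1 Y0 K0 b(2) a(1,2) sum_bdd(1) sum_centred(1)]
    by (simp only: c1_def W_def)
  have c0: "0 \<le> c0"
    using expectation_mult_additive_nonneg[OF intY0 Y1 K1 b(1) a(2,1) sum_bdd(2) sum_centred(2)]
    by (simp only: c0_def W_def add.commute)

  \<comment> \<open>Arm-wise moments of the potential outcomes\<close>
  have factor: "(\<integral>x. h (P x) * g (?U x) \<partial>M) = (\<integral>x. h (P x) \<partial>M) * (\<integral>x. g (?U x) \<partial>M)"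
    if "h \<in> borel_measurable borel" "integrable M (\<lambda>x. h (P x))"
      "g \<in> borel_measurable (borel \<Otimes>\<^sub>M borel)" "integrable M (\<lambda>x. g (?U x))"
    for h and g :: "real \<times> real \<Rightarrow> real"
    \<comment> \<open>\<open>P\<close> is a function of \<open>Z\<close>, hence independent of the
      potential outcomes.\<close>
    by (rule indep_set_expectation_mult[OF Z_indep_U])
      (use that measurable_compose[OF propensity(1)] U_comp in simp_all)
  \<comment> \<open>The treatment becomes \<open>P + W\<close>; as \<open>W\<close> is itself a
    function of the potential outcomes, both resulting products split by independence.\<close>
  have treated: "(\<integral>x. A x * (indicator B (P x) * g (?U x)) \<partial>M)
      = (\<integral>x. indicator B (P x) * P x \<partial>M) * (\<integral>x. g (?U x) \<partial>M)
        + (\<integral>x. indicator B (P x) \<partial>M) * (\<integral>x. g (?U x) * W x \<partial>M)"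
    if B [measurable]: "B \<in> sets borel" and g [measurable]: "g \<in> borel_measurable (borel \<Otimes>\<^sub>M borel)"
      and int_g: "integrable M (\<lambda>x. g (?U x))"
    for B and g :: "real \<times> real \<Rightarrow> real"
  proof -
    have int_B: "integrable M (\<lambda>x. indicator B (P x) :: real)"
      by (rule integrable_const_bound[where B=1]) (auto simp: indicator_def)
    have int_BP: "integrable M (\<lambda>x. indicator B (P x) * P x)"
      using integrable_mult_bounded[OF int_B P P_bdd] .
    have int_gW: "integrable M (\<lambda>x. g (?U x) * W x)"
      using integrable_mult_bounded[OF int_g W_meas W_bdd] .
    have int_gB: "integrable M (\<lambda>x. indicator B (P x) * g (?U x))"
      using integrable_mult_bounded[OF int_g, of "\<lambda>x. indicator B (P x)" 1]
      by (simp add: mult.commute indicator_def)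
    have "(\<integral>x. A x * (indicator B (P x) * g (?U x)) \<partial>M)
        = (\<integral>x. (indicator B (P x) * g (?U x)) * (P x + W x) \<partial>M)"
      using X_comp[of "\<lambda>z. indicator B (fst z) * g (snd z)"] int_gB
      by (intro A_to_PW) simp_all
    also have "\<dots> = (\<integral>x. (indicator B (P x) * P x) * g (?U x) + indicator B (P x) * (g (?U x) * W x) \<partial>M)"
      by (simp add: algebra_simps)
    also have "\<dots> = (\<integral>x. (indicator B (P x) * P x) * g (?U x) \<partial>M)
        + (\<integral>x. indicator B (P x) * (g (?U x) * W x) \<partial>M)"
    proof (rule Bochner_Integration.integral_add)
      show "integrable M (\<lambda>x. indicator B (P x) * P x * g (?U x))"
        using integrable_mult_bounded[OF int_gB P P_bdd] by (simp add: ac_simps)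
      show "integrable M (\<lambda>x. indicator B (P x) * (g (?U x) * W x))"
        using integrable_mult_bounded[OF int_gB W_meas W_bdd] by (simp add: ac_simps)
    qed
    also have "(\<integral>x. (indicator B (P x) * P x) * g (?U x) \<partial>M)
        = (\<integral>x. indicator B (P x) * P x \<partial>M) * (\<integral>x. g (?U x) \<partial>M)"
      using factor[of "\<lambda>\<pi>. indicator B \<pi> * \<pi>" g] int_BP int_g by simp
    also have "(\<integral>x. indicator B (P x) * (g (?U x) * W x) \<partial>M)
        = (\<integral>x. indicator B (P x) \<partial>M) * (\<integral>x. g (?U x) * W x \<partial>M)"
      using factor[of "indicator B" "\<lambda>u. g u * (\<delta> (fst u) + \<eta> (snd u))"] int_B int_gW
      by (simp add: W_def)
    finally show ?thesis .
  qed
  have treated1: "(\<integral>x. A x * (indicator B (P x) * Y1 x) \<partial>M)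
      = (\<integral>x. indicator B (P x) * P x \<partial>M) * m1 + (\<integral>x. indicator B (P x) \<partial>M) * c1"
    if "B \<in> sets borel" for B
    using treated[OF that, of fst] intY1 by (simp add: m1_def c1_def)
  have treated0: "(\<integral>x. A x * (indicator B (P x) * Y0 x) \<partial>M)
      = (\<integral>x. indicator B (P x) * P x \<partial>M) * m0 + (\<integral>x. indicator B (P x) \<partial>M) * c0"
    if "B \<in> sets borel" for B
    using treated[OF that, of snd] intY0 by (simp add: m0_def c0_def)
  \<comment> \<open>The treated part is subtracted from the total, which factorises; this turns
    \<open>c0\<close> into \<open>- c0\<close>.\<close>
  have untreated0: "(\<integral>x. (1 - A x) * (indicator B (P x) * Y0 x) \<partial>M)
      = (\<integral>x. indicator B (P x) * (1 - P x) \<partial>M) * m0 + (\<integral>x. indicator B (P x) \<partial>M) * (- c0)"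
    if B [measurable]: "B \<in> sets borel" for B
  proof -
    have int_B: "integrable M (\<lambda>x. indicator B (P x) :: real)"
      by (rule integrable_const_bound[where B=1]) (auto simp: indicator_def)
    have int_BP: "integrable M (\<lambda>x. indicator B (P x) * P x)"
      using integrable_mult_bounded[OF int_B P P_bdd] .
    have int_BY: "integrable M (\<lambda>x. indicator B (P x) * Y0 x)"
      using integrable_mult_bounded[OF intY0, of "\<lambda>x. indicator B (P x)" 1]
      by (simp add: mult.commute indicator_def)
    have int_ABY: "integrable M (\<lambda>x. A x * (indicator B (P x) * Y0 x))"
      using integrable_mult_bounded[OF int_BY A A_bdd(1)] by (simp add: mult.commute)
    have BY: "(\<integral>x. indicator B (P x) * Y0 x \<partial>M) = (\<integral>x. indicator B (P x) \<partial>M) * m0"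
      using factor[of "indicator B" snd] int_B intY0 by (simp add: m0_def)
    show ?thesis
      using int_B int_BP int_BY int_ABY
      by (simp add: left_diff_distrib right_diff_distrib treated0[OF B] BY)
  qed

  \<comment> \<open>Closed forms of the outcome regressions\<close>
  have \<nu>_A: "(\<integral>x. A x * (indicator B (P x) * \<nu> i (P x)) \<partial>M)
      = (\<integral>x. P x * (indicator B (P x) * \<nu> i (P x)) \<partial>M)"
    and int_\<nu>B: "integrable M (\<lambda>x. indicator B (P x) * \<nu> i (P x))"
    if B [measurable]: "B \<in> sets borel" and i: "i \<in> {0, 1}" for B i
  proof -
    have \<nu>i [measurable]: "\<nu> i \<in> borel_measurable borel" and int_i: "integrable M (\<lambda>x. \<nu> i (P x))"
      using i \<nu> int\<nu> by auto
    show *: "integrable M (\<lambda>x. indicator B (P x) * \<nu> i (P x))"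
      using integrable_mult_bounded[OF int_i, of "\<lambda>x. indicator B (P x)" 1]
      by (simp add: mult.commute indicator_def)
    \<comment> \<open>A function of \<open>P\<close> is a function of \<open>Z\<close>, so the
      treatment may be replaced by \<open>P\<close>.\<close>
    have "(\<lambda>x. indicator B (P x) * \<nu> i (P x)) \<in> borel_measurable (gen_by M Z N)"
      by (rule measurable_compose[OF propensity(1), of "\<lambda>\<pi>. indicator B \<pi> * \<nu> i \<pi>"]) measurable
    then show "(\<integral>x. A x * (indicator B (P x) * \<nu> i (P x)) \<partial>M)
      = (\<integral>x. P x * (indicator B (P x) * \<nu> i (P x)) \<partial>M)"
      using * by (rule A_to_P)
  qed
  have \<nu>1: "AE x in M. \<nu> 1 (P x) = m1 + c1 / P x" "(\<integral>x. A x * \<nu> 1 (P x) \<partial>M) = p * m1 + c1"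
  proof -
    have J: "A x = of_bool (A x = 1)" if "x \<in> space M" for x
      using A01[OF that] by auto
    have Y1_eq: "Y x = Y1 x" if "x \<in> space M" "A x = 1" for x
      using Y[OF that(1)] that(2) by simp
    have J_n: "(\<integral>x. A x * (indicator B (P x) * \<nu> 1 (P x)) \<partial>M)
        = (\<integral>x. P x * (indicator B (P x) * \<nu> 1 (P x)) \<partial>M)" if "B \<in> sets borel" for B
      using that by (rule \<nu>_A) simp
    have q_meas: "(\<lambda>\<pi>::real. \<pi>) \<in> borel_measurable borel" by measurable
    note * = arm_regression[where q="\<lambda>\<pi>. \<pi>" and J=A and y=Y1, OF A P \<nu>(1) int\<nu>(1) int_Y \<nu>_eq J Y1_eq
        q_meas overlap J_n treated1]
    show "AE x in M. \<nu> 1 (P x) = m1 + c1 / P x" by (rule *(1))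
    show "(\<integral>x. A x * \<nu> 1 (P x) \<partial>M) = p * m1 + c1" unfolding p_def by (rule *(2))
  qed
  have \<nu>0: "AE x in M. \<nu> 0 (P x) = m0 + (- c0) / (1 - P x)"
    "(\<integral>x. (1 - A x) * \<nu> 0 (P x) \<partial>M) = (1 - p) * m0 - c0"
  proof -
    have J_n: "(\<integral>x. (1 - A x) * (indicator B (P x) * \<nu> 0 (P x)) \<partial>M)
        = (\<integral>x. (1 - P x) * (indicator B (P x) * \<nu> 0 (P x)) \<partial>M)" if B: "B \<in> sets borel" for B
      using \<nu>_A[OF B, of 0] int_\<nu>B[OF B, of 0]
        integrable_mult_bounded[OF int_\<nu>B[OF B, of 0] A A_bdd(1)]
        integrable_mult_bounded[OF int_\<nu>B[OF B, of 0] P P_bdd]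
      by (simp add: left_diff_distrib mult.commute)
    have q: "AE x in M. 0 < 1 - P x \<and> 1 - P x < 1"
      using overlap by eventually_elim auto
    have J: "1 - A x = of_bool (A x = 0)" if "x \<in> space M" for x
      using A01[OF that] by auto
    have Y0_eq: "Y x = Y0 x" if "x \<in> space M" "A x = 0" for x
      using Y[OF that(1)] that(2) by simp
    have q_meas: "(\<lambda>\<pi>::real. 1 - \<pi>) \<in> borel_measurable borel" by measurable
    \<comment> \<open>The untreated arm is the generic regression with propensity
      \<open>1 - \<pi>\<close> and \<open>r = - c0\<close>.\<close>
    note * = arm_regression[where q="\<lambda>\<pi>. 1 - \<pi>" and J="\<lambda>x. 1 - A x" and y=Y0,
        OF A P \<nu>(2) int\<nu>(2) int_Y \<nu>_eq J Y0_eq q_meas q J_n untreated0]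
    show "AE x in M. \<nu> 0 (P x) = m0 + (- c0) / (1 - P x)" by (rule *(1))
    have "(\<integral>x. (1 - A x) * \<nu> 0 (P x) \<partial>M) = (\<integral>x. 1 - P x \<partial>M) * m0 + - c0" by (rule *(2))
    also have "(\<integral>x. 1 - P x \<partial>M) = 1 - p"
      using int_P by (simp add: p_def prob_space)
    finally show "(\<integral>x. (1 - A x) * \<nu> 0 (P x) \<partial>M) = (1 - p) * m0 - c0" by simp
  qed

  \<comment> \<open>Jensen bounds for the averaged regressions\<close>
  have E\<nu>1: "m1 + c1 / p \<le> (\<integral>x. \<nu> 1 (P x) \<partial>M)"
    unfolding p_def
    by (rule expectation_reciprocal_ge[OF int\<nu>(1) int_P _ _ \<nu>1(1) c1])
      (use overlap p in \<open>auto simp: p_def\<close>)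
  have E\<nu>0: "(\<integral>x. \<nu> 0 (P x) \<partial>M) \<le> m0 - c0 / (1 - p)"
  proof -
    \<comment> \<open>The coefficient of \<open>1 / (1 - P)\<close> in \<open>\<nu> 0\<close> is
      \<open>- c0\<close>, so the reciprocal bound is applied to the negated regression, where the
      coefficient is non-negative.\<close>
    have "- m0 + c0 / expectation (\<lambda>x. 1 - P x) \<le> (\<integral>x. - \<nu> 0 (P x) \<partial>M)"
    proof (rule expectation_reciprocal_ge[OF _ _ _ _ _ c0])
      show "AE x in M. - \<nu> 0 (P x) = - m0 + c0 / (1 - P x)"
        using \<nu>0(1) by eventually_elim simp
      show "AE x in M. 0 < 1 - P x"
        using overlap by eventually_elim simp
      show "0 < expectation (\<lambda>x. 1 - P x)"
        using int_P p by (simp add: prob_space p_def)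
    qed (use int\<nu> int_P in simp_all)
    then show ?thesis
      using int_P by (simp add: prob_space p_def)
  qed

  \<comment> \<open>Expectations within the arms\<close>
  have prob1: "prob (?S 1) = p"
  proof -
    have "prob (?S 1) = (\<integral>x. indicator (?S 1) x \<partial>M)" by simp
    also have "\<dots> = expectation A"
      by (intro Bochner_Integration.integral_cong refl ind1)
    finally show ?thesis using EA by simp
  qed
  have prob0: "prob (?S 0) = 1 - p"
  proof -
    have "prob (?S 0) = (\<integral>x. indicator (?S 0) x \<partial>M)" by simp
    also have "\<dots> = (\<integral>x. 1 - A x \<partial>M)"
      by (intro Bochner_Integration.integral_cong refl ind0)
    finally show ?thesis using EA int_A by (simp add: prob_space)
  qed
  have arm1: "(\<integral>x. f x \<partial>arm M A 1) = (\<integral>x. A x * f x \<partial>M) / p" if "f \<in> borel_measurable M" for f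
  proof -
    have "(\<integral>x. indicator (?S 1) x * f x \<partial>M) = (\<integral>x. A x * f x \<partial>M)"
      by (intro Bochner_Integration.integral_cong refl arg_cong2[where f="(*)"] ind1)
    with integral_arm[OF A that, of 1] p show ?thesis by (simp add: prob1)
  qed
  have arm0: "(\<integral>x. f x \<partial>arm M A 0) = (\<integral>x. (1 - A x) * f x \<partial>M) / (1 - p)"
    if "f \<in> borel_measurable M" for f
  proof -
    have "(\<integral>x. indicator (?S 0) x * f x \<partial>M) = (\<integral>x. (1 - A x) * f x \<partial>M)"
      by (intro Bochner_Integration.integral_cong refl arg_cong2[where f="(*)"] ind0)
    with integral_arm[OF A that, of 0] p show ?thesis by (simp add: prob0)
  qed
  have compl: "(\<integral>x. (1 - A x) * f x \<partial>M) = expectation f - (\<integral>x. A x * f x \<partial>M)"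
    if f: "integrable M f" for f
  proof -
    have "integrable M (\<lambda>x. A x * f x)"
      using integrable_mult_bounded[OF f A A_bdd(1)] by (simp add: mult.commute)
    then show ?thesis using f by (simp add: left_diff_distrib)
  qed
  have AY1: "(\<integral>x. A x * Y1 x \<partial>M) = p * m1 + c1" and AY0: "(\<integral>x. A x * Y0 x \<partial>M) = p * m0 + c0"
    using treated1[of UNIV] treated0[of UNIV] by (simp_all add: p_def prob_space)
  have cY1: "(\<integral>x. (1 - A x) * Y1 x \<partial>M) = (1 - p) * m1 - c1"
    and cY0: "(\<integral>x. (1 - A x) * Y0 x \<partial>M) = (1 - p) * m0 - c0"
    unfolding compl[OF intY1] compl[OF intY0] AY1 AY0 m1_def[symmetric] m0_def[symmetric]
    by (simp_all add: left_diff_distrib)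
  have AY: "(\<integral>x. A x * Y x \<partial>M) = p * m1 + c1"
  proof -
    have "(\<integral>x. A x * Y x \<partial>M) = (\<integral>x. A x * Y1 x \<partial>M)"
      by (rule Bochner_Integration.integral_cong) (use A01 Y in fastforce)+
    then show ?thesis by (simp add: AY1)
  qed
  have cY: "(\<integral>x. (1 - A x) * Y x \<partial>M) = (1 - p) * m0 - c0"
  proof -
    have "(\<integral>x. (1 - A x) * Y x \<partial>M) = (\<integral>x. (1 - A x) * Y0 x \<partial>M)"
      by (rule Bochner_Integration.integral_cong) (use A01 Y in fastforce)+
    then show ?thesis by (simp only: cY0)
  qed
  have distr_arm: "(\<integral>\<pi>. \<nu> i \<pi> \<partial>distr (arm M A j) borel P) = (\<integral>x. \<nu> i (P x) \<partial>arm M A j)"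
    if "i \<in> {0, 1}" for i j
    using that \<nu> by (intro integral_distr) (auto simp: arm_def)
  have distr_M: "(\<integral>\<pi>. \<nu> i \<pi> \<partial>distr M borel P) = (\<integral>x. \<nu> i (P x) \<partial>M)" if "i \<in> {0, 1}" for i
    using that \<nu> by (intro integral_distr) auto

  \<comment> \<open>The six inequalities\<close>
  have unadj: "ACE_unadj M A Y = m1 + c1 / p - (m0 - c0 / (1 - p))"
    using p by (simp add: ACE_unadj_def arm1 arm0 AY cY add_divide_distrib diff_divide_distrib)
  have true1: "ACE_true_arm M A Y1 Y0 1 = m1 + c1 / p - (m0 + c0 / p)"
    using p by (simp add: ACE_true_arm_def arm1 AY1 AY0 add_divide_distrib)
  have true0: "ACE_true_arm M A Y1 Y0 0 = m1 - c1 / (1 - p) - (m0 - c0 / (1 - p))"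
    using p by (simp add: ACE_true_arm_def arm0 cY1 cY0 diff_divide_distrib)
  have "ACE1_adj M A P Y \<nu> \<ge> ACE_unadj M A Y"
  proof -
    \<comment> \<open>The untreated share of the expectation of \<open>\<nu> 0 (P x)\<close> is
      known exactly, so the upper bound on the total bounds the treated share.\<close>
    have "(\<integral>x. A x * \<nu> 0 (P x) \<partial>M) \<le> p * (m0 - c0 / (1 - p))"
    proof -
      have "p * (m0 - c0 / (1 - p)) = (m0 - c0 / (1 - p)) - ((1 - p) * m0 - c0)"
        using p by (simp add: field_simps)
      then show ?thesis
        using compl[OF int\<nu>(2)] \<nu>0(2) E\<nu>0 by linarith
    qed
    then have "(\<integral>x. A x * \<nu> 0 (P x) \<partial>M) / p \<le> m0 - c0 / (1 - p)"
      using p by (simp add: pos_divide_le_eq mult.commute)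
    then show ?thesis
      using p by (simp add: ACE1_adj_def unadj distr_arm arm1 AY add_divide_distrib)
  qed
  moreover have "ACE0_adj M A P Y \<nu> \<ge> ACE_unadj M A Y"
  proof -
    \<comment> \<open>Here the exact treated share turns the lower bound on the total into one on
      the untreated share.\<close>
    have "(1 - p) * (m1 + c1 / p) \<le> (\<integral>x. (1 - A x) * \<nu> 1 (P x) \<partial>M)"
    proof -
      have "(1 - p) * (m1 + c1 / p) = (m1 + c1 / p) - (p * m1 + c1)"
        using p by (simp add: field_simps)
      then show ?thesis
        using compl[OF int\<nu>(1)] \<nu>1(2) E\<nu>1 by linarith
    qed
    then have "m1 + c1 / p \<le> (\<integral>x. (1 - A x) * \<nu> 1 (P x) \<partial>M) / (1 - p)"
      using p by (simp add: pos_le_divide_eq mult.commute)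
    then show ?thesis
      using p by (simp add: ACE0_adj_def unadj distr_arm arm0 cY diff_divide_distrib)
  qed
  moreover have "ACE_adj M P \<nu> \<ge> ACE_unadj M A Y"
    using E\<nu>1 E\<nu>0 by (simp add: ACE_adj_def unadj distr_M)
  \<comment> \<open>The unadjusted effect exceeds the true one by
    \<open>c0 / p + c0 / (1 - p)\<close> on the treated, by \<open>c1 / p + c1 / (1 - p)\<close> on
    the untreated and by \<open>c1 / p + c0 / (1 - p)\<close> overall.\<close>
  moreover have "0 \<le> c1 / p" "0 \<le> c0 / p" "0 \<le> c1 / (1 - p)" "0 \<le> c0 / (1 - p)"
    using c1 c0 p by simp_all
  then have "ACE_unadj M A Y \<ge> ACE_true_arm M A Y1 Y0 1" "ACE_unadj M A Y \<ge> ACE_true_arm M A Y1 Y0 0"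
    "ACE_unadj M A Y \<ge> ACE_true M Y1 Y0"
    by (simp_all add: unadj true1 true0 ACE_true_def m1_def m0_def)
  ultimately show ?thesis by simp
qed

end
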